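(* Let $R$ be a commutative ring with identity and let $S$ be a multiplicatively closed subset of $R$. If $R$ is a nonnil-$S$-Laskerian ring and its nilradical $Nil(R)$ is $S$-decomposable, then $R$ has $S$-Noetherian spectrum.
   Context: $Nil(R)$ denotes the nilradical of $R$ (the set of nilpotent elements). An ideal $I$ of $R$ is nonnil if $I\nsubseteq Nil(R)$. $rad(I)=\sqrt{I}$ denotes the radical of an ideal $I$. A proper ideal $Q$ of $R$ with $Q\cap S=\emptyset$ is $S$-primary if there exists $s\in S$ such that for all $a,b\in R$, if $ab\in Q$ then $sa\in Q$ or $sb\in rad(Q)$. An ideal $I$ of $R$ with $I\cap S=\emptyset$ is $S$-decomposable if it is a finite intersection of $S$-primary ideals of $R$. $R$ is nonnil-$S$-Laskerian if every nonnil ideal of $R$ disjoint from $S$ is $S$-decomposable. An ideal $I$ of $R$ is radically $S$-finite if there exist $s\in S$ and a finitely generated ideal $J$ of $R$ such that $sI\subseteq\sqrt{J}\subseteq\sqrt{I}$. $R$ has $S$-Noetherian spectrum (satisfies the $S$-Noetherian spectrum property) if every prime ideal of $R$ is radically $S$-finite. *)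

theory Defs
  imports "HOL-Algebra.Ideal"
begin

definition radical :: "('a, 'b) ring_scheme \<Rightarrow> 'a set \<Rightarrow> 'a set" where
  "radical R I = {x \<in> carrier R. \<exists>n::nat. n > 0 \<and> x [^]\<^bsub>R\<^esub> n \<in> I}"

definition nilradical :: "('a, 'b) ring_scheme \<Rightarrow> 'a set" where
  "nilradical R = {x \<in> carrier R. \<exists>n::nat. n > 0 \<and> x [^]\<^bsub>R\<^esub> n = \<zero>\<^bsub>R\<^esub>}"

definition nonnil :: "('a, 'b) ring_scheme \<Rightarrow> 'a set \<Rightarrow> bool" where
  "nonnil R I \<longleftrightarrow> \<not> I \<subseteq> nilradical R"

definition S_primary :: "('a, 'b) ring_scheme \<Rightarrow> 'a set \<Rightarrow> 'a set \<Rightarrow> bool" where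
  "S_primary R S Q \<longleftrightarrow>
     ideal Q R \<and> Q \<noteq> carrier R \<and> Q \<inter> S = {} \<and>
     (\<exists>s\<in>S. \<forall>a\<in>carrier R. \<forall>b\<in>carrier R.
        a \<otimes>\<^bsub>R\<^esub> b \<in> Q \<longrightarrow> s \<otimes>\<^bsub>R\<^esub> a \<in> Q \<or> s \<otimes>\<^bsub>R\<^esub> b \<in> radical R Q)"

text \<open>The family is required to be nonempty because \<open>\<Inter>{}\<close> is the whole type
  rather than the ring. The empty intersection of ideals of \<open>R\<close>, which would be
  \<open>carrier R\<close>, is never disjoint from a set \<open>S\<close> containing \<open>\<one>\<close>.\<close>

definition S_decomposable :: "('a, 'b) ring_scheme \<Rightarrow> 'a set \<Rightarrow> 'a set \<Rightarrow> bool" where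
  "S_decomposable R S I \<longleftrightarrow>
     ideal I R \<and> I \<inter> S = {} \<and>
     (\<exists>F. finite F \<and> F \<noteq> {} \<and> (\<forall>Q\<in>F. S_primary R S Q) \<and> I = \<Inter>F)"

definition nonnil_S_Laskerian :: "('a, 'b) ring_scheme \<Rightarrow> 'a set \<Rightarrow> bool" where
  "nonnil_S_Laskerian R S \<longleftrightarrow>
     (\<forall>I. ideal I R \<and> nonnil R I \<and> I \<inter> S = {} \<longrightarrow> S_decomposable R S I)"

definition finitely_generated_ideal :: "('a, 'b) ring_scheme \<Rightarrow> 'a set \<Rightarrow> bool" where
  "finitely_generated_ideal R J \<longleftrightarrow> (\<exists>A. finite A \<and> A \<subseteq> carrier R \<and> J = genideal R A)"

definition radically_S_finite :: "('a, 'b) ring_scheme \<Rightarrow> 'a set \<Rightarrow> 'a set \<Rightarrow> bool" where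
  "radically_S_finite R S I \<longleftrightarrow>
     ideal I R \<and>
     (\<exists>s\<in>S. \<exists>J. finitely_generated_ideal R J \<and>
        (\<lambda>x. s \<otimes>\<^bsub>R\<^esub> x) ` I \<subseteq> radical R J \<and> radical R J \<subseteq> radical R I)"

definition S_Noetherian_spectrum :: "('a, 'b) ring_scheme \<Rightarrow> 'a set \<Rightarrow> bool" where
  "S_Noetherian_spectrum R S \<longleftrightarrow> (\<forall>P. primeideal P R \<longrightarrow> radically_S_finite R S P)"

end

theory Submission
  imports Defs
begin

text \<open>
  For an ideal \<open>J\<close> and \<open>z \<in> R\<close> let \<open>T(J, z) = S_colon_radical R S J z\<close> be the ideal of all \<open>w\<close> with \<open>s w\<^sup>k z \<in> J\<close> for some
  \<open>s \<in> S\<close> and \<open>k\<close>. If \<open>Q\<close> is \<open>S\<close>-primary, then \<open>T(Q, 1)\<close> is prime and \<open>T(Q, z)\<close> is either \<open>R\<close> or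
  \<open>T(Q, 1)\<close>; hence for an \<open>S\<close>-decomposable \<open>I\<close> only finitely many ideals \<open>T(I, z)\<close> exist.

  Let \<open>P\<close> be a prime disjoint from \<open>S\<close> that is not radically \<open>S\<close>-finite. Prime avoidance gives
  \<open>p\<^sub>0, p\<^sub>1, \<dots> \<in> P\<close> such that, with \<open>J\<^sub>n = Nil(R) + (p\<^sub>0, \<dots>, p\<^sub>n\<^sub>-\<^sub>1)\<close>, each \<open>p\<^sub>n\<close> lies outside
  \<open>T(J\<^sub>n, 1)\<close> and is regular modulo \<open>J\<^sub>n\<close> away from \<open>P\<close>: if \<open>p\<^sub>n z \<in> J\<^sub>n\<close> then \<open>P \<subseteq> T(J\<^sub>n, z)\<close>.
  Put \<open>x\<^sub>n = p\<^sub>0 \<cdots> p\<^sub>n\<^sub>-\<^sub>1\<close> and let \<open>I\<close> be generated by all \<open>x\<^sub>n p\<^sub>n\<^sup>2\<close>. Then \<open>p\<^sub>i \<in> T(I, x\<^sub>m)\<close> for \<open>i < m\<close>,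
  but cancelling \<open>p\<^sub>0, \<dots>, p\<^sub>m\<^sub>-\<^sub>1\<close> one after the other shows \<open>p\<^sub>m\<^sub>+\<^sub>1 \<notin> T(I, x\<^sub>m)\<close>, so infinitely many
  ideals \<open>T(I, x\<^sub>m)\<close> are distinct, although \<open>I\<close> is nonnil and contained in \<open>P\<close>.
\<close>

section \<open>Multiplicative sets and radicals of saturated colon ideals\<close>

text \<open>For a submonoid \<open>S\<close> of a commutative ring this is the multiplicative set
  generated by \<open>S\<close> and \<open>w\<close>. Treating \<open>s w^k\<close> as one
  multiplier lets witnesses be combined by a single product.\<close>

definition powers_times :: "('a, 'b) ring_scheme \<Rightarrow> 'a set \<Rightarrow> 'a \<Rightarrow> 'a set" where
  "powers_times R S w = {s \<otimes>\<^bsub>R\<^esub> w [^]\<^bsub>R\<^esub> (k::nat) | s k. s \<in> S}"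

text \<open>For an ideal \<open>J\<close> this is the radical of the \<open>S\<close>-saturation of
  the colon ideal \<open>(J : z)\<close>. Since exponent 0 is allowed, it is the whole ring as soon
  as \<open>s z\<close> lies in \<open>J\<close> for one \<open>s\<close> in
  \<open>S\<close>.\<close>

definition S_colon_radical :: "('a, 'b) ring_scheme \<Rightarrow> 'a set \<Rightarrow> 'a set \<Rightarrow> 'a \<Rightarrow> 'a set" where
  "S_colon_radical R S J z =
     {w \<in> carrier R. \<exists>t\<in>powers_times R S w. t \<otimes>\<^bsub>R\<^esub> z \<in> J}"

text \<open>The product of the individual witnesses works for all \<open>Q\<close> at once. It is
  applied with \<open>M = pw w\<close> to intersect ideals and with \<open>M = S\<close> to find a
  uniform \<open>s\<close>.\<close>

lemma submonoid_finite_common_multiple: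
  assumes "submonoid M G" "finite F"
    and "\<And>Q. Q \<in> F \<Longrightarrow> \<exists>t\<in>M. Pr Q t"
    and mult: "\<And>Q t u. \<lbrakk>Q \<in> F; t \<in> M; u \<in> M; Pr Q t\<rbrakk> \<Longrightarrow> Pr Q (u \<otimes>\<^bsub>G\<^esub> t)"
    and comm: "\<And>t u. \<lbrakk>t \<in> M; u \<in> M\<rbrakk> \<Longrightarrow> t \<otimes>\<^bsub>G\<^esub> u = u \<otimes>\<^bsub>G\<^esub> t"
  shows "\<exists>t\<in>M. \<forall>Q\<in>F. Pr Q t"
proof -
  interpret submonoid M G by fact
  show ?thesis
    using assms(2,3) mult
  proof (induction F rule: finite_induct)
    case empty
    show ?case using one_closed by blast
  next
    case (insert Q F)
    obtain t where t: "t \<in> M" "\<forall>Q\<in>F. Pr Q t"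
      using insert.IH insert.prems by (metis insertCI)
    obtain u where u: "u \<in> M" "Pr Q u"
      using insert.prems(1) by blast
    have "Pr Q' (u \<otimes>\<^bsub>G\<^esub> t)" if "Q' \<in> insert Q F" for Q'
    proof (cases "Q' = Q")
      case True
      then show ?thesis using insert.prems(2)[of Q u t] t u comm by simp
    next
      case False
      then show ?thesis using insert.prems(2)[of Q' t u] t u that by blast
    qed
    then show ?case using t u m_closed by blast
  qed
qed

lemma (in monoid) submonoid_nat_pow_closed:
  assumes "submonoid M G" "t \<in> M"
  shows "t [^] (n::nat) \<in> M"
proof -
  interpret M: submonoid M G by fact
  show ?thesis using assms(2) by (induction n) auto
qed

text \<open>Induction on \<open>m + n\<close> takes the place of the binomial theorem: one factor
  \<open>a + b\<close> splits \<open>z\<close> into \<open>a z\<close> and \<open>b z\<close>, and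
  each of these needs one power less of \<open>a\<close> or of \<open>b\<close>.\<close>

lemma (in cring) add_pow_mult_in_ideal:
  fixes m n :: nat
  assumes J: "ideal J R" and ab [simp]: "a \<in> carrier R" "b \<in> carrier R"
  shows "\<lbrakk>z \<in> carrier R; a [^] m \<otimes> z \<in> J; b [^] n \<otimes> z \<in> J\<rbrakk> \<Longrightarrow> \<exists>N::nat. (a \<oplus> b) [^] N \<otimes> z \<in> J"
proof (induction "m + n" arbitrary: m n z)
  case 0
  then have "(a \<oplus> b) [^] (0::nat) \<otimes> z \<in> J" by simp
  then show ?case ..
next
  case (Suc l)
  interpret ideal J R by fact
  note [simp] = Suc.prems(1)
  show ?case
  proof (cases "m = 0 \<or> n = 0")
    case True
    then have "z \<in> J" using Suc.prems by force
    then have "(a \<oplus> b) [^] (0::nat) \<otimes> z \<in> J" by simp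
    then show ?thesis ..
  next
    case False
    then obtain m' n' where mn: "m = Suc m'" "n = Suc n'" by (meson not0_implies_Suc)
    have "a [^] m' \<otimes> (a \<otimes> z) \<in> J" "b [^] n' \<otimes> (b \<otimes> z) \<in> J"
      using Suc.prems mn by (simp_all add: m_assoc)
    moreover have "b [^] n \<otimes> (a \<otimes> z) = a \<otimes> (b [^] n \<otimes> z)" "a [^] m \<otimes> (b \<otimes> z) = b \<otimes> (a [^] m \<otimes> z)"
      by (simp_all add: m_lcomm)
    then have "b [^] n \<otimes> (a \<otimes> z) \<in> J" "a [^] m \<otimes> (b \<otimes> z) \<in> J"
      using Suc.prems I_l_closed by simp_all
    ultimately obtain N1 N2 :: nat where N:
        "(a \<oplus> b) [^] N1 \<otimes> (a \<otimes> z) \<in> J" "(a \<oplus> b) [^] N2 \<otimes> (b \<otimes> z) \<in> J"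
      using Suc.hyps(1)[of m' n "a \<otimes> z"] Suc.hyps(1)[of m n' "b \<otimes> z"] Suc.hyps(2) mn by auto
    let ?c = "a \<oplus> b"
    have "?c [^] Suc (N1 + N2) \<otimes> z
        = ?c [^] N2 \<otimes> (?c [^] N1 \<otimes> (a \<otimes> z)) \<oplus> ?c [^] N1 \<otimes> (?c [^] N2 \<otimes> (b \<otimes> z))"
    proof -
      have "?c [^] Suc (N1 + N2) = ?c [^] N1 \<otimes> ?c [^] N2 \<otimes> ?c"
        by (simp add: nat_pow_mult)
      moreover have "x \<otimes> y \<otimes> (a \<oplus> b) \<otimes> z = y \<otimes> (x \<otimes> (a \<otimes> z)) \<oplus> x \<otimes> (y \<otimes> (b \<otimes> z))"
        if "x \<in> carrier R" "y \<in> carrier R" for x y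
        using that Suc.prems(1) ab by algebra
      ultimately show ?thesis by simp
    qed
    also have "\<dots> \<in> J"
      using a_closed[OF I_l_closed[OF N(1)] I_l_closed[OF N(2)]] by simp
    finally show ?thesis ..
  qed
qed

locale cring_submonoid = cring R + S: submonoid S R for R (structure) and S
begin

abbreviation "pw \<equiv> powers_times R S"
abbreviation "scr \<equiv> S_colon_radical R S"

lemma S_carr [simp]: "s \<in> S \<Longrightarrow> s \<in> carrier R"
  using S.subset by blast

lemma powers_times_carr [simp]: "\<lbrakk>w \<in> carrier R; t \<in> pw w\<rbrakk> \<Longrightarrow> t \<in> carrier R"
  by (auto simp: powers_times_def)

lemma powers_timesI: "s \<in> S \<Longrightarrow> s \<otimes> w [^] (k::nat) \<in> pw w"
  by (auto simp: powers_times_def)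

lemma powers_times_submonoid:
  assumes w: "w \<in> carrier R"
  shows "submonoid (pw w) R"
proof
  show "pw w \<subseteq> carrier R" using w by auto
  show "\<one> \<in> pw w" using powers_timesI[of \<one> w 0] by simp
  fix x y assume "x \<in> pw w" "y \<in> pw w"
  then obtain s k t l where *: "s \<in> S" "t \<in> S" "x = s \<otimes> w [^] (k::nat)" "y = t \<otimes> w [^] (l::nat)"
    by (auto simp: powers_times_def)
  have "x \<otimes> y = (s \<otimes> t) \<otimes> (w [^] k \<otimes> w [^] l)"
    using * w by (simp add: m_ac)
  then show "x \<otimes> y \<in> pw w"
    using * w powers_timesI[of "s \<otimes> t" w "k + l"] by (simp add: nat_pow_mult)
qed

lemma powers_times_mult: "\<lbrakk>w \<in> carrier R; t \<in> pw w; u \<in> pw w\<rbrakk> \<Longrightarrow> t \<otimes> u \<in> pw w"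
  by (rule submonoid.m_closed[OF powers_times_submonoid])

lemma S_subset_powers_times: "\<lbrakk>w \<in> carrier R; s \<in> S\<rbrakk> \<Longrightarrow> s \<in> pw w"
  using powers_timesI[of s w 0] by simp

lemma self_in_powers_times: "w \<in> carrier R \<Longrightarrow> w \<in> pw w"
  using powers_timesI[of \<one> w 1] by simp

lemma S_colon_radicalI: "\<lbrakk>w \<in> carrier R; t \<in> pw w; t \<otimes> z \<in> J\<rbrakk> \<Longrightarrow> w \<in> scr J z"
  by (auto simp: S_colon_radical_def)

lemma S_colon_radicalE:
  assumes "w \<in> scr J z"
  obtains t where "w \<in> carrier R" "t \<in> pw w" "t \<in> carrier R" "t \<otimes> z \<in> J"
  using assms by (auto simp: S_colon_radical_def)

lemma S_colon_radical_ideal: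
  assumes J: "ideal J R" and z [simp]: "z \<in> carrier R"
  shows "ideal (scr J z) R"
proof -
  interpret J: ideal J R by fact
  have mult: "x \<otimes> a \<in> scr J z" if a: "a \<in> scr J z" and x: "x \<in> carrier R" for a x
  proof -
    obtain s k where s: "s \<in> S" "a \<in> carrier R" "s \<otimes> a [^] (k::nat) \<otimes> z \<in> J"
      using a by (auto simp: S_colon_radical_def powers_times_def)
    have "s \<otimes> (x \<otimes> a) [^] k \<otimes> z = x [^] k \<otimes> (s \<otimes> a [^] k \<otimes> z)"
      using s x by (simp add: nat_pow_distrib m_ac)
    also have "\<dots> \<in> J" using J.I_l_closed[OF s(3), of "x [^] k"] x by simp
    finally show ?thesis using s x powers_timesI by (intro S_colon_radicalI) auto
  qed
  have add: "a \<oplus> b \<in> scr J z" if a: "a \<in> scr J z" and b: "b \<in> scr J z" for a b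
  proof -
    obtain s k where s: "s \<in> S" "a \<in> carrier R" "s \<otimes> a [^] (k::nat) \<otimes> z \<in> J"
      using a by (auto simp: S_colon_radical_def powers_times_def)
    obtain t l where t: "t \<in> S" "b \<in> carrier R" "t \<otimes> b [^] (l::nat) \<otimes> z \<in> J"
      using b by (auto simp: S_colon_radical_def powers_times_def)
    \<comment> \<open>Both multipliers from \<open>S\<close> are absorbed into \<open>z\<close>, so
      that a power of \<open>a\<close> and a power of \<open>b\<close> send the same element into
      \<open>J\<close>.\<close>
    let ?z = "s \<otimes> t \<otimes> z"
    have "a [^] k \<otimes> ?z = t \<otimes> (s \<otimes> a [^] k \<otimes> z)" "b [^] l \<otimes> ?z = s \<otimes> (t \<otimes> b [^] l \<otimes> z)"
      using s t by (simp_all add: m_ac)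
    then have "a [^] k \<otimes> ?z \<in> J" "b [^] l \<otimes> ?z \<in> J"
      using s t J.I_l_closed by simp_all
    then obtain N :: nat where "(a \<oplus> b) [^] N \<otimes> ?z \<in> J"
      using add_pow_mult_in_ideal[OF J, of a b ?z k l] s t by auto
    moreover have "(a \<oplus> b) [^] N \<otimes> ?z = (s \<otimes> t) \<otimes> (a \<oplus> b) [^] N \<otimes> z"
      using s t by (simp add: m_ac)
    ultimately show ?thesis using s t powers_timesI[of "s \<otimes> t"] by (intro S_colon_radicalI) auto
  qed
  have zero: "\<zero> \<in> scr J z"
    using S_colon_radicalI[of \<zero> \<zero> z J] self_in_powers_times[of \<zero>] by simp
  have sub: "scr J z \<subseteq> carrier R" by (auto simp: S_colon_radical_def)
  show ?thesis
  proof (rule idealI)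
    show "ring R" by (rule ring_axioms)
    show "subgroup (scr J z) (add_monoid R)"
    proof (rule add.subgroupI)
      fix a assume a: "a \<in> scr J z"
      then have "\<ominus> a = (\<ominus> \<one>) \<otimes> a" using sub by (metis l_minus l_one one_closed subsetD)
      then show "\<ominus> a \<in> scr J z" using mult[OF a, of "\<ominus> \<one>"] by simp
    qed (use sub zero add in auto)
    fix a x assume ax: "a \<in> scr J z" "x \<in> carrier R"
    then show "x \<otimes> a \<in> scr J z" by (rule mult)
    then show "a \<otimes> x \<in> scr J z" using ax sub m_comm by (metis subsetD)
  qed
qed

text \<open>The nontrivial inclusion needs one multiplier in \<open>pw w\<close> for all members of
  \<open>F\<close>, hence the finiteness of \<open>F\<close>.\<close>

lemma S_colon_radical_Inter:
  assumes F: "finite F" "F \<noteq> {}" "\<And>Q. Q \<in> F \<Longrightarrow> ideal Q R" and z: "z \<in> carrier R"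
  shows "scr (\<Inter>F) z = (\<Inter>Q\<in>F. scr Q z)"
proof
  show "scr (\<Inter>F) z \<subseteq> (\<Inter>Q\<in>F. scr Q z)" by (auto simp: S_colon_radical_def)
  show "(\<Inter>Q\<in>F. scr Q z) \<subseteq> scr (\<Inter>F) z"
  proof
    fix w assume w: "w \<in> (\<Inter>Q\<in>F. scr Q z)"
    then have wc: "w \<in> carrier R" using F(2) by (auto simp: S_colon_radical_def)
    have "\<exists>t\<in>pw w. \<forall>Q\<in>F. t \<otimes> z \<in> Q"
    proof (rule submonoid_finite_common_multiple[OF powers_times_submonoid[OF wc] F(1)])
      show "\<And>Q. Q \<in> F \<Longrightarrow> \<exists>t\<in>pw w. t \<otimes> z \<in> Q"
        using w by (auto simp: S_colon_radical_def)
      show "u \<otimes> t \<otimes> z \<in> Q" if "Q \<in> F" "t \<in> pw w" "u \<in> pw w" "t \<otimes> z \<in> Q" for Q t u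
        using that wc z F(3) ideal.I_l_closed[of Q R "t \<otimes> z" u] by (simp add: m_assoc)
    qed (use wc m_comm in auto)
    then show "w \<in> scr (\<Inter>F) z" using wc by (auto simp: S_colon_radical_def)
  qed
qed

end

section \<open>Radicals of ideals and prime avoidance\<close>

text \<open>The two sides differ only in admitting exponent 0, which is repaired by raising
  \<open>k\<close> to \<open>k + 1\<close>. Facts about \<open>scr\<close> thus specialise to
  ordinary radicals by taking \<open>S\<close> to be trivial.\<close>

lemma (in cring) radical_eq_S_colon_radical:
  assumes "ideal I R"
  shows "radical R I = S_colon_radical R {\<one>} I \<one>"
proof -
  interpret ideal I R by fact
  have "\<exists>n>0. x [^] (n::nat) \<in> I" if "x \<in> carrier R" "x [^] (k::nat) \<in> I" for x k
    using that I_l_closed[of "x [^] k" x] by (metis nat_pow_Suc2 zero_less_Suc)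
  then show ?thesis
    by (auto simp: radical_def S_colon_radical_def powers_times_def)
qed

lemma (in cring) radical_ideal:
  assumes "ideal I R"
  shows "ideal (radical R I) R"
proof -
  have "cring_submonoid R {\<one>}"
    by (intro cring_submonoid.intro cring_axioms submonoid.intro) auto
  then interpret cring_submonoid R "{\<one>}" .
  show ?thesis using assms by (simp add: radical_eq_S_colon_radical S_colon_radical_ideal)
qed

lemma (in cring) subset_radical: "ideal I R \<Longrightarrow> I \<subseteq> radical R I"
proof
  fix x assume "ideal I R" "x \<in> I"
  then have "x \<in> carrier R" "x [^] (1::nat) \<in> I" using ideal.Icarr[of I R x] by simp_all
  then show "x \<in> radical R I" unfolding radical_def using zero_less_one by blast
qed

lemma (in cring) radicalD_pow:
  assumes "x \<in> carrier R" "x [^] (n::nat) \<in> radical R I" "n > 0"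
  shows "x \<in> radical R I"
proof -
  obtain m :: nat where "m > 0" "(x [^] n) [^] m \<in> I" using assms by (auto simp: radical_def)
  then have "n * m > 0" "x [^] (n * m) \<in> I" using assms by (simp_all add: nat_pow_pow)
  then show ?thesis using assms(1) unfolding radical_def by blast
qed


text \<open>Choose an element outside \<open>Q\<close> in each ideal; by primality their product
  stays outside \<open>Q\<close>.\<close>

lemma (in cring) prime_avoids_finite_Inter:
  assumes Q: "primeideal Q R" and "finite G"
    and "\<And>I. I \<in> G \<Longrightarrow> ideal I R \<and> \<not> I \<subseteq> Q"
  shows "\<exists>y\<in>carrier R - Q. \<forall>I\<in>G. y \<in> I"
  using assms(2,3)
proof (induction G rule: finite_induct)
  case empty
  interpret Q: primeideal Q R by fact
  have "\<one> \<notin> Q" using Q.one_imp_carrier Q.I_notcarr by blast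
  then show ?case by auto
next
  case (insert I G)
  interpret Q: primeideal Q R by fact
  interpret I: ideal I R using insert.prems by blast
  obtain y where y: "y \<in> carrier R - Q" "\<forall>I\<in>G. y \<in> I" using insert by blast
  obtain a where a: "a \<in> I" "a \<notin> Q" using insert.prems by blast
  have "a \<in> carrier R" using a by (simp add: I.Icarr)
  have "y \<otimes> a \<notin> Q" using Q.I_prime y a \<open>a \<in> carrier R\<close> by blast
  moreover have "y \<otimes> a \<in> I" using I.I_l_closed a y by simp
  moreover have "y \<otimes> a \<in> I'" if "I' \<in> G" for I'
    using insert.prems[of I'] that y \<open>a \<in> carrier R\<close> ideal.I_r_closed[of I' R] by blast
  ultimately show ?case using y \<open>a \<in> carrier R\<close> by (intro bexI[of _ "y \<otimes> a"]) auto
qed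

lemma (in cring) prime_avoidance:
  assumes P: "ideal P R" and "finite F"
    and "\<And>Q. Q \<in> F \<Longrightarrow> primeideal Q R \<and> \<not> P \<subseteq> Q"
  shows "\<exists>p\<in>P. \<forall>Q\<in>F. p \<notin> Q"
  using assms(2,3)
proof (induction F rule: finite_psubset_induct)
  case (psubset F)
  interpret P: ideal P R by fact
  show ?case
  proof (cases "F = {}")
    case True
    then show ?thesis using P.zero_closed by blast
  next
    case False
    \<comment> \<open>Minimality means that no other member of \<open>F\<close> lies inside
      \<open>Q\<close>. Hence some \<open>y\<close> in \<open>P\<close> and in all other members
      avoids \<open>Q\<close>, and if \<open>x\<close> avoids all members but \<open>Q\<close>, then
      \<open>x + y\<close> avoids every one.\<close>
    then obtain Q where Q: "Q \<in> F" and min: "\<forall>Q'\<in>F. Q' \<subseteq> Q \<longrightarrow> Q = Q'"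
      using finite_has_minimal[OF psubset.hyps False] by blast
    then interpret Q: primeideal Q R using psubset.prems by blast
    have "F - {Q} \<subset> F" using Q by blast
    then obtain x where x: "x \<in> P" "\<forall>Q'\<in>F - {Q}. x \<notin> Q'"
      using psubset.IH[of "F - {Q}"] psubset.prems by blast
    show ?thesis
    proof (cases "x \<in> Q")
      case False
      then show ?thesis using x by blast
    next
      case True
      have "\<exists>y\<in>carrier R - Q. \<forall>I\<in>insert P (F - {Q}). y \<in> I"
      proof (rule prime_avoids_finite_Inter)
        fix I assume "I \<in> insert P (F - {Q})"
        then show "ideal I R \<and> \<not> I \<subseteq> Q"
          using P psubset.prems Q min primeideal.axioms(1) by fast
      qed (use psubset.hyps Q.primeideal in auto)
      then obtain y where y: "y \<in> carrier R" "y \<notin> Q" "y \<in> P" "\<And>I. I \<in> F - {Q} \<Longrightarrow> y \<in> I"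
        by blast
      have xc: "x \<in> carrier R" using x P.Icarr by blast
      have eqs: "(x \<oplus> y) \<ominus> y = x" "(y \<oplus> x) \<ominus> x = y" using xc y(1) by algebra+
      have "x \<oplus> y \<notin> Q'" if "Q' \<in> F" for Q'
      proof
        assume xy: "x \<oplus> y \<in> Q'"
        interpret Q': primeideal Q' R using psubset.prems that by blast
        show False
        proof (cases "Q' = Q")
          case True
          then have "(y \<oplus> x) \<ominus> x \<in> Q"
            using xy \<open>x \<in> Q\<close> xc y(1) Q.a_closed Q.a_inv_closed by (simp add: a_minus_def a_comm)
          then show False using eqs y by simp
        next
          case False
          then have "(x \<oplus> y) \<ominus> y \<in> Q'"
            using xy y(4)[of Q'] that Q'.a_closed Q'.a_inv_closed by (simp add: a_minus_def)
          then show False using eqs x that False by simp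
        qed
      qed
      then show ?thesis using x y P.a_closed by blast
    qed
  qed
qed

section \<open>\<open>S\<close>-primary and \<open>S\<close>-decomposable ideals\<close>

context cring_submonoid
begin

lemma S_primaryE:
  assumes "S_primary R S Q"
  obtains s where "ideal Q R" "Q \<inter> S = {}" "s \<in> S"
    "\<And>a b. \<lbrakk>a \<in> carrier R; b \<in> carrier R; a \<otimes> b \<in> Q\<rbrakk> \<Longrightarrow> s \<otimes> a \<in> Q \<or> s \<otimes> b \<in> radical R Q"
  using assms unfolding S_primary_def by blast

lemma one_notin_S_colon_radical:
  assumes "Q \<inter> S = {}"
  shows "\<one> \<notin> scr Q \<one>"
  using assms by (auto simp: S_colon_radical_def powers_times_def)

lemma S_colon_radical_of_radical:
  assumes w: "w \<in> carrier R" and t: "t \<in> pw w" "t \<in> radical R Q"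
  shows "w \<in> scr Q \<one>"
proof -
  obtain n :: nat where "t [^] n \<in> Q" using t by (auto simp: radical_def)
  moreover have "t [^] n \<in> pw w"
    using submonoid_nat_pow_closed[OF powers_times_submonoid[OF w] t(1)] .
  ultimately show ?thesis using w t by (intro S_colon_radicalI[of w "t [^] n"]) auto
qed

text \<open>The \<open>S\<close>-primary condition is applied to the product of \<open>t a^k\<close>
  and \<open>b^k\<close>; in either alternative the constant \<open>s\<close> is absorbed into
  \<open>pw a\<close> or \<open>pw b\<close>.\<close>

lemma S_primary_S_colon_radical_prime:
  assumes "S_primary R S Q"
  shows "primeideal (scr Q \<one>) R"
proof -
  obtain s where Q: "ideal Q R" "Q \<inter> S = {}" "s \<in> S"
    "\<And>a b. \<lbrakk>a \<in> carrier R; b \<in> carrier R; a \<otimes> b \<in> Q\<rbrakk> \<Longrightarrow> s \<otimes> a \<in> Q \<or> s \<otimes> b \<in> radical R Q"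
    using S_primaryE[OF assms] by blast
  show ?thesis
  proof (rule primeidealI)
    show "ideal (scr Q \<one>) R" using Q S_colon_radical_ideal by simp
    show "carrier R \<noteq> scr Q \<one>" using one_notin_S_colon_radical[OF Q(2)] by auto
    fix a b assume ab: "a \<in> carrier R" "b \<in> carrier R" "a \<otimes> b \<in> scr Q \<one>"
    then obtain t k where t: "t \<in> S" "t \<otimes> (a \<otimes> b) [^] (k::nat) \<in> Q"
      by (auto simp: S_colon_radical_def powers_times_def)
    have "t \<otimes> (a \<otimes> b) [^] k = (t \<otimes> a [^] k) \<otimes> b [^] k"
      using t ab by (simp add: nat_pow_distrib m_ac)
    then have "s \<otimes> (t \<otimes> a [^] k) \<in> Q \<or> s \<otimes> b [^] k \<in> radical R Q"
      using Q(4)[of "t \<otimes> a [^] k" "b [^] k"] t ab by simp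
    then show "a \<in> scr Q \<one> \<or> b \<in> scr Q \<one>"
    proof
      assume "s \<otimes> (t \<otimes> a [^] k) \<in> Q"
      then have "(s \<otimes> t) \<otimes> a [^] k \<otimes> \<one> \<in> Q" using Q t ab by (simp add: m_assoc)
      then show ?thesis using S_colon_radicalI[of a _ \<one> Q] powers_timesI[of "s \<otimes> t" a k] Q t ab by blast
    next
      assume "s \<otimes> b [^] k \<in> radical R Q"
      then show ?thesis using S_colon_radical_of_radical[of b] powers_timesI Q(3) ab by blast
    qed
  qed (rule cring_axioms)
qed

lemma S_primary_S_colon_radical_cases:
  assumes "S_primary R S Q" and z: "z \<in> carrier R"
  shows "scr Q z = carrier R \<or> scr Q z = scr Q \<one>"
proof -
  obtain s where Q: "ideal Q R" "Q \<inter> S = {}" "s \<in> S"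
    "\<And>a b. \<lbrakk>a \<in> carrier R; b \<in> carrier R; a \<otimes> b \<in> Q\<rbrakk> \<Longrightarrow> s \<otimes> a \<in> Q \<or> s \<otimes> b \<in> radical R Q"
    using S_primaryE[OF assms(1)] by blast
  show ?thesis
  proof (cases "s \<otimes> z \<in> Q")
    case True
    then have "scr Q z = carrier R"
      using S_subset_powers_times Q(3) S_colon_radicalI by (auto simp: S_colon_radical_def)
    then show ?thesis ..
  next
    case False
    have "w \<in> scr Q \<one>" if w: "w \<in> scr Q z" for w
    proof -
      obtain t where t: "w \<in> carrier R" "t \<in> pw w" "t \<in> carrier R" "t \<otimes> z \<in> Q"
        using w by (rule S_colon_radicalE)
      then have "s \<otimes> t \<in> radical R Q" using Q(4)[of z t] z False by (simp add: m_comm)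
      moreover have "s \<otimes> t \<in> pw w"
        using t S_subset_powers_times Q(3) by (intro powers_times_mult) auto
      ultimately show ?thesis using S_colon_radical_of_radical t by blast
    qed
    moreover have "w \<in> scr Q z" if w: "w \<in> scr Q \<one>" for w
    proof -
      obtain t where t: "w \<in> carrier R" "t \<in> pw w" "t \<in> carrier R" "t \<otimes> \<one> \<in> Q"
        using w by (rule S_colon_radicalE)
      then have "t \<otimes> z \<in> Q" using ideal.I_r_closed[OF Q(1), of t z] z by simp
      then show ?thesis using t S_colon_radicalI by blast
    qed
    ultimately show ?thesis by blast
  qed
qed

text \<open>The constant of the \<open>S\<close>-primary condition serves all \<open>w\<close>: if
  \<open>t w^k\<close> is in \<open>Q\<close> with \<open>t\<close> in \<open>S\<close>, then
  \<open>s t\<close> is in \<open>S\<close>, hence not in \<open>Q\<close>, and so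
  \<open>s w^k\<close> is in the radical.\<close>

lemma S_primary_uniform_radical:
  assumes "S_primary R S Q" and "P \<subseteq> scr Q \<one>"
  shows "\<exists>s\<in>S. \<forall>w\<in>P. s \<otimes> w \<in> radical R Q"
proof -
  obtain s where Q: "ideal Q R" "Q \<inter> S = {}" "s \<in> S"
    "\<And>a b. \<lbrakk>a \<in> carrier R; b \<in> carrier R; a \<otimes> b \<in> Q\<rbrakk> \<Longrightarrow> s \<otimes> a \<in> Q \<or> s \<otimes> b \<in> radical R Q"
    using S_primaryE[OF assms(1)] by blast
  interpret rad: ideal "radical R Q" R using radical_ideal Q(1) .
  have "s \<otimes> w \<in> radical R Q" if wP: "w \<in> P" for w
  proof -
    obtain t k where w: "w \<in> carrier R" "t \<in> S" "t \<otimes> w [^] (k::nat) \<in> Q"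
      using subsetD[OF assms(2) wP] by (auto simp: S_colon_radical_def powers_times_def)
    have "s \<otimes> t \<notin> Q" using w Q(2,3) S.m_closed by blast
    then have "s \<otimes> w [^] k \<in> radical R Q" using Q(4)[of t "w [^] k"] w by simp
    \<comment> \<open>The factor \<open>s^k w\<close> completes \<open>s w^k\<close> to the power
      \<open>(s w)^(k+1)\<close>, whose exponent is positive even for \<open>k = 0\<close>.\<close>
    then have "(s [^] k \<otimes> w) \<otimes> (s \<otimes> w [^] k) \<in> radical R Q"
      using rad.I_l_closed w Q(3) by simp
    moreover have "(s [^] k \<otimes> w) \<otimes> (s \<otimes> w [^] k) = (s \<otimes> w) [^] Suc k"
      using w Q(3) by (simp add: nat_pow_distrib m_ac)
    ultimately show ?thesis using radicalD_pow[of "s \<otimes> w" "Suc k"] w Q(3) by simp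
  qed
  then show ?thesis using Q(3) by blast
qed

lemma S_decomposableE:
  assumes "S_decomposable R S I"
  obtains F where "finite F" "F \<noteq> {}" "\<And>Q. Q \<in> F \<Longrightarrow> S_primary R S Q"
    "\<And>Q. Q \<in> F \<Longrightarrow> ideal Q R" "I = \<Inter>F"
proof -
  obtain F where "finite F" "F \<noteq> {}" "\<forall>Q\<in>F. S_primary R S Q" "I = \<Inter>F"
    using assms unfolding S_decomposable_def by blast
  then show ?thesis using that[of F] by (auto simp: S_primary_def)
qed

text \<open>Every \<open>scr I z\<close> is an intersection of members of the finite set consisting
  of the ring and the primes \<open>scr Q \<one>\<close>, and a finite set has finitely many
  subsets.\<close>

lemma S_decomposable_finite_S_colon_radicals:
  assumes "S_decomposable R S I"
  shows "finite (scr I ` carrier R)"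
proof -
  obtain F where F: "finite F" "F \<noteq> {}" "\<And>Q. Q \<in> F \<Longrightarrow> S_primary R S Q"
    "\<And>Q. Q \<in> F \<Longrightarrow> ideal Q R" "I = \<Inter>F"
    using S_decomposableE[OF assms] by metis
  let ?X = "insert (carrier R) ((\<lambda>Q. scr Q \<one>) ` F)"
  have "scr I z \<in> Inter ` Pow ?X" if z: "z \<in> carrier R" for z
  proof -
    have "(\<lambda>Q. scr Q z) ` F \<subseteq> ?X"
      using S_primary_S_colon_radical_cases[OF F(3) z] by blast
    then show ?thesis using S_colon_radical_Inter[OF F(1,2,4) z] F(5) by blast
  qed
  then have "scr I ` carrier R \<subseteq> Inter ` Pow ?X" by blast
  then show ?thesis using F(1) by (meson finite_Pow_iff finite_imageI finite_insert finite_subset)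
qed

lemma radical_Inter:
  assumes F: "finite F" "F \<noteq> {}" "\<And>Q. Q \<in> F \<Longrightarrow> ideal Q R"
  shows "radical R (\<Inter>F) = (\<Inter>Q\<in>F. radical R Q)"
proof -
  have "cring_submonoid R {\<one>}"
    by (intro cring_submonoid.intro cring_axioms submonoid.intro) auto
  then interpret one: cring_submonoid R "{\<one>}" .
  show ?thesis
    using one.S_colon_radical_Inter[OF F, of \<one>] radical_eq_S_colon_radical[OF i_Intersect[OF F(3,2)]]
      radical_eq_S_colon_radical[OF F(3)] by simp
qed

text \<open>Prime avoidance yields \<open>p\<close> outside those primes \<open>scr Q \<one>\<close>
  that do not contain \<open>P\<close>. If \<open>p z\<close> is in \<open>J\<close>, then
  \<open>scr Q z\<close> is the whole ring for these \<open>Q\<close>, while for the other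
  \<open>Q\<close> it contains \<open>scr Q \<one>\<close> and so \<open>P\<close>.\<close>

lemma exists_almost_regular:
  assumes P: "ideal P R" and dec: "S_decomposable R S J"
    and not_fin: "\<not> (\<exists>s\<in>S. \<forall>w\<in>P. s \<otimes> w \<in> radical R J)"
  shows "\<exists>p\<in>P. p \<notin> scr J \<one> \<and> (\<forall>z\<in>carrier R. p \<otimes> z \<in> J \<longrightarrow> P \<subseteq> scr J z)"
proof -
  obtain F where F: "finite F" "F \<noteq> {}" "\<And>Q. Q \<in> F \<Longrightarrow> S_primary R S Q"
    "\<And>Q. Q \<in> F \<Longrightarrow> ideal Q R" "J = \<Inter>F"
    using S_decomposableE[OF dec] by metis
  define F' where "F' = {Q \<in> F. \<not> P \<subseteq> scr Q \<one>}"
  \<comment> \<open>If every component had \<open>P\<close> inside \<open>scr Q \<one>\<close>, the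
    product of their uniform constants would send \<open>P\<close> into the radical of
    \<open>J\<close>.\<close>
  have "F' \<noteq> {}"
  proof
    assume "F' = {}"
    then have "\<exists>s\<in>S. \<forall>Q\<in>F. \<forall>w\<in>P. s \<otimes> w \<in> radical R Q"
    proof (intro submonoid_finite_common_multiple[OF S.is_submonoid F(1)])
      show "\<exists>s\<in>S. \<forall>w\<in>P. s \<otimes> w \<in> radical R Q" if "Q \<in> F" for Q
        using S_primary_uniform_radical[OF F(3)] that \<open>F' = {}\<close> by (auto simp: F'_def)
      show "\<forall>w\<in>P. u \<otimes> t \<otimes> w \<in> radical R Q"
        if "Q \<in> F" "t \<in> S" "u \<in> S" "\<forall>w\<in>P. t \<otimes> w \<in> radical R Q" for Q t u
      proof
        fix w assume w: "w \<in> P"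
        have "u \<otimes> (t \<otimes> w) \<in> radical R Q"
          using ideal.I_l_closed[OF radical_ideal[OF F(4)[OF that(1)]]] that w by simp
        then show "u \<otimes> t \<otimes> w \<in> radical R Q"
          using that ideal.Icarr[OF P w] by (simp add: m_assoc)
      qed
    qed (use m_comm in auto)
    then show False using not_fin radical_Inter[OF F(1,2,4)] F(5) by auto
  qed
  have "\<exists>p\<in>P. \<forall>Q'\<in>(\<lambda>Q. scr Q \<one>) ` F'. p \<notin> Q'"
    using S_primary_S_colon_radical_prime F(1,3) by (intro prime_avoidance[OF P]) (auto simp: F'_def)
  then obtain p where p: "p \<in> P" "\<And>Q. Q \<in> F' \<Longrightarrow> p \<notin> scr Q \<one>" by blast
  have pc: "p \<in> carrier R" using ideal.Icarr[OF P p(1)] .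
  have scrJ: "scr J z = (\<Inter>Q\<in>F. scr Q z)" if "z \<in> carrier R" for z
    using S_colon_radical_Inter[OF F(1,2,4) that] F(5) by simp
  have "P \<subseteq> scr J z" if z: "z \<in> carrier R" and pz: "p \<otimes> z \<in> J" for z
  proof -
    have "P \<subseteq> scr Q z" if Q: "Q \<in> F" for Q
    proof (cases "Q \<in> F'")
      case True
      have "p \<in> scr Q z" using S_colon_radicalI[OF pc self_in_powers_times[OF pc]] pz Q F(5) by blast
      then have "scr Q z = carrier R"
        using S_primary_S_colon_radical_cases[OF F(3)[OF Q] z] p(2)[OF True] by blast
      then show ?thesis using ideal.Icarr[OF P] by blast
    next
      case False
      have "scr Q \<one> \<subseteq> scr Q z"
        using S_primary_S_colon_radical_cases[OF F(3)[OF Q] z] by (auto simp: S_colon_radical_def)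
      then show ?thesis using False Q by (auto simp: F'_def)
    qed
    then show ?thesis using scrJ[OF z] by blast
  qed
  moreover have "p \<notin> scr J \<one>" using \<open>F' \<noteq> {}\<close> p(2) scrJ[OF one_closed] by (auto simp: F'_def)
  ultimately show ?thesis using p(1) by blast
qed

end

section \<open>Radicals of primes and sums with a principal ideal\<close>

lemma radical_mono: "I \<subseteq> J \<Longrightarrow> radical R I \<subseteq> radical R J"
  by (auto simp: radical_def)

lemma (in cring) radical_primeideal:
  assumes "primeideal P R"
  shows "radical R P \<subseteq> P"
proof -
  interpret P: primeideal P R by fact
  have "x \<in> P" if "x \<in> carrier R" "x [^] (n::nat) \<in> P" for x n
    using that
  proof (induction n)
    case 0
    then show ?case using P.I_notcarr P.one_imp_carrier by simp
  next
    case (Suc n)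
    then show ?case using P.I_prime[of "x [^] n" x] by auto
  qed
  then show ?thesis by (auto simp: radical_def)
qed

lemma (in cring) add_cgenideal_iff:
  assumes "c \<in> carrier R"
  shows "a \<in> I <+> PIdl c \<longleftrightarrow> (\<exists>i\<in>I. \<exists>r\<in>carrier R. a = i \<oplus> r \<otimes> c)"
  by (auto simp: set_add_def' cgenideal_def)

lemma (in cring) add_cgenideal_supset:
  assumes "ideal I R" and c: "c \<in> carrier R"
  shows "I \<subseteq> I <+> PIdl c" and "c \<in> I <+> PIdl c"
proof -
  interpret ideal I R by fact
  have "a = a \<oplus> \<zero> \<otimes> c" if "a \<in> I" for a using that c Icarr by simp
  then show "I \<subseteq> I <+> PIdl c" unfolding add_cgenideal_iff[OF c] subset_iff by blast
  have "c = \<zero> \<oplus> \<one> \<otimes> c" using c by simp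
  then show "c \<in> I <+> PIdl c" unfolding add_cgenideal_iff[OF c] using zero_closed by blast
qed

lemma (in cring) add_cgenideal_subset:
  fixes I K :: "'a set"
  assumes "ideal K R" "I \<subseteq> K" "c \<in> K"
  shows "I <+> PIdl c \<subseteq> K"
proof -
  interpret K: ideal K R by fact
  have "c \<in> carrier R" using assms(3) K.Icarr by blast
  then show ?thesis
    using assms(2,3) K.a_closed[OF subsetD[OF assms(2)] K.I_l_closed[OF assms(3)]]
    by (auto simp: add_cgenideal_iff)
qed

lemma (in cring) add_cgenideal_ideal: "\<lbrakk>ideal I R; c \<in> carrier R\<rbrakk> \<Longrightarrow> ideal (I <+> PIdl c) R"
  by (intro add_ideals cgenideal_ideal)

section \<open>Almost regular sequences\<close>

context cring_submonoid
begin

lemma S_colon_radical_absorb: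
  assumes w: "w \<in> scr J (t \<otimes> z)" and t: "t \<in> pw w" and z: "z \<in> carrier R"
  shows "w \<in> scr J z"
proof -
  obtain u where u: "w \<in> carrier R" "u \<in> pw w" "u \<in> carrier R" "u \<otimes> (t \<otimes> z) \<in> J"
    using w by (rule S_colon_radicalE)
  have "t \<in> carrier R" using t u by simp
  then have "(u \<otimes> t) \<otimes> z \<in> J" using u z by (simp add: m_assoc)
  then show ?thesis using S_colon_radicalI[OF u(1) powers_times_mult[OF u(1,2) t]] by blast
qed

text \<open>The elements \<open>u\<close> and \<open>u - r c\<close> agree modulo \<open>c\<close>.
  With \<open>c = p m\<close> this carries membership from \<open>J m\<close> to
  \<open>J (Suc m)\<close>.\<close>

lemma S_colon_radical_diff_multiple:
  assumes J: "ideal J R" and w: "w \<in> scr J (u \<ominus> r \<otimes> c)"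
    and [simp]: "u \<in> carrier R" "r \<in> carrier R" "c \<in> carrier R"
  shows "w \<in> scr (J <+> PIdl c) u"
proof -
  obtain t where t: "w \<in> carrier R" "t \<in> pw w" "t \<in> carrier R" "t \<otimes> (u \<ominus> r \<otimes> c) \<in> J"
    using w by (rule S_colon_radicalE)
  have "t \<otimes> r \<in> carrier R" using t(3) by simp
  moreover have "t \<otimes> u = t \<otimes> (u \<ominus> r \<otimes> c) \<oplus> (t \<otimes> r) \<otimes> c" using t(3) assms(3-5) by algebra
  ultimately have "t \<otimes> u \<in> J <+> PIdl c" using t(4) unfolding add_cgenideal_iff[OF assms(5)] by blast
  then show ?thesis using t S_colon_radicalI by blast
qed

lemma almost_regular_sequence_contradiction:
  fixes p x :: "nat \<Rightarrow> 'a" and J :: "nat \<Rightarrow> 'a set"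
  assumes P: "ideal P R" and pP: "\<And>n. p n \<in> P"
    and J: "\<And>n. ideal (J n) R" "\<And>n. J (Suc n) = J n <+> PIdl (p n)"
    and notin: "\<And>n. p n \<notin> scr (J n) \<one>"
    and regular: "\<And>n z. \<lbrakk>z \<in> carrier R; p n \<otimes> z \<in> J n\<rbrakk> \<Longrightarrow> P \<subseteq> scr (J n) z"
    and x: "x 0 = \<one>" "\<And>n. x (Suc n) = x n \<otimes> p n"
    and I: "I = Idl (range (\<lambda>n. x n \<otimes> p n \<otimes> p n))"
    and fin: "finite (scr I ` carrier R)"
  shows False
proof -
  interpret P: ideal P R by fact
  have pc [simp]: "p n \<in> carrier R" for n using pP P.Icarr by blast
  have xc [simp]: "x n \<in> carrier R" for n by (induction n) (simp_all add: x)
  have gens: "range (\<lambda>n. x n \<otimes> p n \<otimes> p n) \<subseteq> carrier R" by auto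
  have Iid: "ideal I R" unfolding I by (rule genideal_ideal[OF gens])
  have gen_I: "x n \<otimes> p n \<otimes> p n \<in> I" for n using genideal_self[OF gens] I by blast
  have x_dvd: "\<exists>y\<in>carrier R. x n = y \<otimes> x k" if "k \<le> n" for k n
    using that
  proof (induction n rule: dec_induct)
    case base
    show ?case by (intro bexI[of _ \<one>]) auto
  next
    case (step n)
    then obtain y where "y \<in> carrier R" "x n = y \<otimes> x k" by blast
    then have "x (Suc n) = (y \<otimes> p n) \<otimes> x k" "y \<otimes> p n \<in> carrier R" by (simp_all add: x m_ac)
    then show ?case by blast
  qed
  \<comment> \<open>\<open>H m\<close> is \<open>J 0\<close> plus the first \<open>m\<close>
    generators of \<open>I\<close>. All later generators are multiples of \<open>x (Suc m)\<close>,
    which gives \<open>I_sub\<close> below.\<close>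
  define H where "H = rec_nat (J 0) (\<lambda>m h. h <+> PIdl (x m \<otimes> p m \<otimes> p m))"
  have H: "H 0 = J 0" "H (Suc m) = H m <+> PIdl (x m \<otimes> p m \<otimes> p m)" for m
    by (simp_all add: H_def)
  have Hid: "ideal (H m) R" for m
    by (induction m) (simp_all add: H J add_cgenideal_ideal)
  have H_mono: "H k \<subseteq> H m" if "k \<le> m" for k m
    using that by (rule lift_Suc_mono_le[rotated]) (simp add: H add_cgenideal_supset Hid)
  \<comment> \<open>Cancels the factors \<open>p 0, ..., p (m-1)\<close> of \<open>x m\<close>. In
    the inductive step the new generator \<open>x m p m p m\<close> is moved to the left: it
    replaces \<open>u\<close> by \<open>?v = u - r p m\<close>, and this correction vanishes modulo
    \<open>J (Suc m)\<close>.\<close>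
  have cancel: "P \<subseteq> scr (J m) u" if "u \<in> carrier R" "x m \<otimes> u \<in> H m" for m u
    using that
  proof (induction m arbitrary: u)
    case 0
    then have "u \<in> J 0" by (simp add: x H)
    then have "p 0 \<otimes> u \<in> J 0" using ideal.I_l_closed[OF J(1)] by simp
    then show ?case by (rule regular[OF 0(1)])
  next
    case (Suc m)
    note u [simp] = Suc.prems(1)
    obtain h r where h: "h \<in> H m" "r \<in> carrier R" "x (Suc m) \<otimes> u = h \<oplus> r \<otimes> (x m \<otimes> p m \<otimes> p m)"
      using Suc.prems(2) by (auto simp: H add_cgenideal_iff)
    have hc: "h \<in> carrier R" using ideal.Icarr[OF Hid h(1)] .
    let ?v = "u \<ominus> r \<otimes> p m"
    have v [simp]: "?v \<in> carrier R" using h by simp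
    have "x m \<otimes> (p m \<otimes> ?v) = x (Suc m) \<otimes> u \<ominus> r \<otimes> (x m \<otimes> p m \<otimes> p m)"
      unfolding x using h(2) xc[of m] pc[of m] u by algebra
    also have "\<dots> = h" unfolding h(3) using h(2) hc xc[of m] pc[of m] by algebra
    finally have "P \<subseteq> scr (J m) (p m \<otimes> ?v)" using Suc.IH[of "p m \<otimes> ?v"] h by simp
    \<comment> \<open>Regularity of \<open>p m\<close> applies to \<open>t ?v\<close>, not to
      \<open>?v\<close>; the extra factor \<open>t\<close> lies in \<open>pw w\<close> and is
      absorbed for this particular \<open>w\<close>.\<close>
    moreover have "w \<in> scr (J m) ?v" if w: "w \<in> P" "w \<in> scr (J m) (p m \<otimes> ?v)" for w
    proof -
      obtain t where t: "w \<in> carrier R" "t \<in> pw w" "t \<in> carrier R" "t \<otimes> (p m \<otimes> ?v) \<in> J m"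
        using w(2) by (rule S_colon_radicalE)
      have "p m \<otimes> (t \<otimes> ?v) \<in> J m" using t v by (simp add: m_lcomm)
      then have "P \<subseteq> scr (J m) (t \<otimes> ?v)" using t v by (intro regular) auto
      then have "w \<in> scr (J m) (t \<otimes> ?v)" using w(1) by (rule subsetD)
      then show ?thesis using t(2) v by (rule S_colon_radical_absorb)
    qed
    ultimately have "w \<in> scr (J m) ?v" if "w \<in> P" for w using that by blast
    then show ?case
      unfolding J(2) by (intro subsetI S_colon_radical_diff_multiple[OF J(1) _ u h(2) pc])
  qed
  have I_sub: "I \<subseteq> H m <+> PIdl (x (Suc m))" (is "_ \<subseteq> ?K") for m
  proof -
    have K: "ideal ?K R" using Hid add_cgenideal_ideal by simp
    have "x n \<otimes> p n \<otimes> p n \<in> ?K" for n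
    proof (cases "n < m")
      case True
      have "x n \<otimes> p n \<otimes> p n \<in> H (Suc n)" using H add_cgenideal_supset(2)[OF Hid] by simp
      then show ?thesis using H_mono[of "Suc n" m] True add_cgenideal_supset(1)[OF Hid, of "x (Suc m)"] by auto
    next
      case False
      then obtain y where y: "y \<in> carrier R" "x (Suc n) = y \<otimes> x (Suc m)" using x_dvd[of "Suc m" "Suc n"] by auto
      have "x n \<otimes> p n \<otimes> p n = (p n \<otimes> y) \<otimes> x (Suc m)" using y x(2)[of n] by (simp add: m_ac)
      then show ?thesis
        using ideal.I_l_closed[OF K add_cgenideal_supset(2)[OF Hid]] y by simp
    qed
    then show ?thesis unfolding I by (intro genideal_minimal[OF K] image_subsetI)
  qed
  \<comment> \<open>The index is \<open>Suc m\<close> because writing \<open>t x m\<close> as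
    \<open>h + r x (Suc m)\<close> leaves the multiple \<open>r p m\<close> after cancelling
    \<open>x m\<close>, and this is killed only in \<open>J (Suc m)\<close>. There \<open>t\<close>
    is absorbed, against \<open>notin\<close>.\<close>
  have out: "p (Suc m) \<notin> scr I (x m)" for m
  proof
    let ?w = "p (Suc m)"
    assume "?w \<in> scr I (x m)"
    then obtain t where t: "t \<in> pw ?w" "t \<in> carrier R" "t \<otimes> x m \<in> I"
      by (rule S_colon_radicalE)
    obtain h r where h: "h \<in> H m" "r \<in> carrier R" "t \<otimes> x m = h \<oplus> r \<otimes> x (Suc m)"
      using subsetD[OF I_sub t(3), of m] by (auto simp: add_cgenideal_iff)
    have hc: "h \<in> carrier R" using ideal.Icarr[OF Hid h(1)] .
    have "x m \<otimes> (t \<ominus> r \<otimes> p m) = t \<otimes> x m \<ominus> r \<otimes> x (Suc m)"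
      unfolding x using h(2) xc[of m] pc[of m] t(2) by algebra
    also have "\<dots> = h" unfolding h(3) using h(2) hc xc[of "Suc m"] by algebra
    finally have "?w \<in> scr (J m) (t \<ominus> r \<otimes> p m)"
      using subsetD[OF cancel pP] h t by simp
    then have "?w \<in> scr (J (Suc m)) (t \<otimes> \<one>)"
      using S_colon_radical_diff_multiple[OF J(1)[of m]] t h J(2)[of m] by simp
    then have "?w \<in> scr (J (Suc m)) \<one>" using t(1) by (rule S_colon_radical_absorb) simp
    then show False using notin by simp
  qed
  \<comment> \<open>For \<open>i < m\<close> the product \<open>x m\<close> contains
    \<open>x i p i\<close>, so one more factor \<open>p i\<close> makes it a multiple of generator
    \<open>i\<close>.\<close>
  have mem: "p i \<in> scr I (x m)" if im: "i < m" for i m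
  proof -
    obtain y where y: "y \<in> carrier R" "x m = y \<otimes> x (Suc i)" using x_dvd[of "Suc i" m] im by auto
    have "p i \<otimes> x m = y \<otimes> (x i \<otimes> p i \<otimes> p i)" using y x(2)[of i] by (simp add: m_ac)
    also have "\<dots> \<in> I" using ideal.I_l_closed[OF Iid gen_I] y by simp
    finally show ?thesis using S_colon_radicalI[OF pc self_in_powers_times[OF pc]] by blast
  qed
  \<comment> \<open>Even indices leave room for the shift in \<open>out\<close>: for
    \<open>i < j\<close> the element \<open>p (2 * i + 1)\<close> lies in
    \<open>scr I (x (2 * j))\<close> but not in \<open>scr I (x (2 * i))\<close>.\<close>
  have "finite (range (\<lambda>j. scr I (x (2 * j))))"
    by (rule finite_subset[OF _ fin]) auto
  then have "\<not> inj (\<lambda>j. scr I (x (2 * j)))" using finite_imageD infinite_UNIV_nat by blast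
  then obtain a b where ab: "a \<noteq> b" "scr I (x (2 * a)) = scr I (x (2 * b))"
    by (auto simp: inj_def)
  have "scr I (x (2 * i)) \<noteq> scr I (x (2 * j))" if ij: "i < j" for i j
    using out[of "2 * i"] mem[of "Suc (2 * i)" "2 * j"] ij by auto
  then show False using ab by (metis nat_neq_iff)
qed

section \<open>Primes meeting \<open>S\<close> and primes disjoint from \<open>S\<close>\<close>

text \<open>The principal ideal of \<open>s\<close> works, since \<open>s w\<close> lies in it for
  every \<open>w\<close>.\<close>

lemma radically_S_finite_meeting_S:
  assumes P: "ideal P R" and s: "s \<in> P" "s \<in> S"
  shows "radically_S_finite R S P"
proof -
  interpret P: ideal P R by fact
  have Idl: "Idl {s} \<subseteq> P" "ideal (Idl {s}) R" "s \<in> Idl {s}"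
    using s genideal_minimal[OF P] genideal_ideal[of "{s}"] genideal_self'[of s] by auto
  have "s \<otimes> w \<in> radical R (Idl {s})" if "w \<in> P" for w
    using ideal.I_r_closed[OF Idl(2,3)] P.Icarr[OF that] subset_radical[OF Idl(2)] by blast
  moreover have "radical R (Idl {s}) \<subseteq> radical R P" using Idl(1) by (rule radical_mono)
  moreover have "finitely_generated_ideal R (Idl {s})"
    using s S_carr unfolding finitely_generated_ideal_def by (intro exI[of _ "{s}"]) auto
  ultimately show ?thesis using P s unfolding radically_S_finite_def by blast
qed

lemma radically_S_finite_of_disjoint_prime:
  assumes Lask: "nonnil_S_Laskerian R S" and nil: "S_decomposable R S (nilradical R)"
    and P: "primeideal P R" and disj: "P \<inter> S = {}"
  shows "radically_S_finite R S P"
proof (rule ccontr)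
  assume contra: "\<not> radically_S_finite R S P"
  interpret P: primeideal P R by fact
  have Pid: "ideal P R" by (rule P.is_ideal)
  have nil_eq: "nilradical R = radical R {\<zero>}" by (auto simp: nilradical_def radical_def)
  \<comment> \<open>Invariant of the ideals \<open>J n\<close>. The finite set \<open>A\<close>
    stands in for generators, since the nilradical may not be finitely generated: if
    \<open>s P\<close> lay in the radical of \<open>J\<close>, it would lie in that of
    \<open>Idl A\<close>, making \<open>P\<close> radically \<open>S\<close>-finite.\<close>
  define C where "C J \<longleftrightarrow> S_decomposable R S J \<and> J \<subseteq> P \<and>
    (\<exists>A. finite A \<and> A \<subseteq> P \<and> J \<subseteq> radical R (Idl A))" for J
  have C_ideal: "ideal J R" if "C J" for J using that by (auto simp: C_def S_decomposable_def)
  have dec: "S_decomposable R S J" if "ideal J R" "J \<subseteq> P" "nonnil R J" for J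
    using Lask that disj unfolding nonnil_S_Laskerian_def by blast
  have ex: "\<exists>p\<in>P. p \<notin> scr J \<one> \<and> (\<forall>z\<in>carrier R. p \<otimes> z \<in> J \<longrightarrow> P \<subseteq> scr J z)" if CJ: "C J" for J
  proof (rule exists_almost_regular[OF Pid])
    show "S_decomposable R S J" using CJ by (simp add: C_def)
    show "\<not> (\<exists>s\<in>S. \<forall>w\<in>P. s \<otimes> w \<in> radical R J)"
    proof
      assume "\<exists>s\<in>S. \<forall>w\<in>P. s \<otimes> w \<in> radical R J"
      then obtain s where s: "s \<in> S" "\<forall>w\<in>P. s \<otimes> w \<in> radical R J" by blast
      obtain A where A: "finite A" "A \<subseteq> P" "J \<subseteq> radical R (Idl A)" using CJ by (auto simp: C_def)
      have "x \<in> radical R (Idl A)" if xJ: "x \<in> radical R J" for x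
      proof -
        obtain n :: nat where "x \<in> carrier R" "n > 0" "x [^] n \<in> J"
          using xJ by (auto simp: radical_def)
        then show ?thesis using A(3) radicalD_pow by blast
      qed
      then have "(\<lambda>w. s \<otimes> w) ` P \<subseteq> radical R (Idl A)" using s by blast
      moreover have "radical R (Idl A) \<subseteq> radical R P"
        using radical_mono[OF genideal_minimal[OF Pid A(2)]] .
      moreover have "finitely_generated_ideal R (Idl A)"
        using A P.a_subset unfolding finitely_generated_ideal_def by blast
      ultimately have "radically_S_finite R S P"
        using Pid s(1) unfolding radically_S_finite_def by blast
      then show False using contra by contradiction
    qed
  qed
  \<comment> \<open>One choice function on all ideals satisfying \<open>C\<close>, so that the
    sequence \<open>J\<close> can be defined by plain recursion.\<close>
  then obtain c where c: "\<And>J. C J \<Longrightarrow> c J \<in> P" "\<And>J. C J \<Longrightarrow> c J \<notin> scr J \<one>"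
    "\<And>J z. \<lbrakk>C J; z \<in> carrier R; c J \<otimes> z \<in> J\<rbrakk> \<Longrightarrow> P \<subseteq> scr J z"
    by metis
  \<comment> \<open>A nilpotent \<open>c J\<close> would have 0 among its multipliers and so lie in
    \<open>scr J \<one>\<close>. Hence each \<open>J (Suc n)\<close> is nonnil and decomposable by
    the Laskerian hypothesis; \<open>J 0\<close> is covered by the hypothesis on the
    nilradical.\<close>
  have not_nil: "c J \<notin> nilradical R" if "C J" for J
  proof
    assume "c J \<in> nilradical R"
    then obtain n :: nat where n: "c J \<in> carrier R" "c J [^] n = \<zero>" by (auto simp: nilradical_def)
    interpret J: ideal J R using C_ideal that .
    have "(\<one> \<otimes> c J [^] n) \<otimes> \<one> \<in> J" using n by simp
    then have "c J \<in> scr J \<one>" by (rule S_colon_radicalI[OF n(1) powers_timesI[OF S.one_closed]])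
    then show False using c(2)[OF that] by simp
  qed
  define J where "J = rec_nat (nilradical R) (\<lambda>_ K. K <+> PIdl (c K))"
  have J: "J 0 = nilradical R" "J (Suc n) = J n <+> PIdl (c (J n))" for n by (simp_all add: J_def)
  have CJ: "C (J n)" for n
  proof (induction n)
    case 0
    have "nilradical R \<subseteq> radical R P"
      using P.zero_closed unfolding nil_eq by (auto simp: radical_def)
    then have "nilradical R \<subseteq> P" using radical_primeideal[OF P] by blast
    moreover have "ideal (Idl {}) R" by (rule genideal_ideal) simp
    then have "\<zero> \<in> Idl {}" by (rule additive_subgroup.zero_closed[OF ideal.axioms(1)])
    then have "nilradical R \<subseteq> radical R (Idl {})" unfolding nil_eq by (auto simp: radical_def)
    ultimately show ?case using nil unfolding C_def J by blast
  next
    case (Suc n)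
    let ?p = "c (J n)"
    have p: "?p \<in> P" "?p \<in> carrier R" using c(1)[OF Suc] P.Icarr by blast+
    have id: "ideal (J (Suc n)) R" using add_cgenideal_ideal C_ideal[OF Suc] p J(2) by simp
    obtain A where A: "finite A" "A \<subseteq> P" "J n \<subseteq> radical R (Idl A)" using Suc by (auto simp: C_def)
    have sub: "J (Suc n) \<subseteq> P"
      unfolding J using add_cgenideal_subset[OF Pid _ p(1)] Suc by (simp add: C_def)
    have "nonnil R (J (Suc n))"
      using not_nil[OF Suc] add_cgenideal_supset(2)[OF C_ideal[OF Suc] p(2)] J(2)
      by (auto simp: nonnil_def)
    then have "S_decomposable R S (J (Suc n))" using dec id sub by blast
    moreover have "J (Suc n) \<subseteq> radical R (Idl (insert ?p A))"
    proof -
      have carr: "insert ?p A \<subseteq> carrier R" using p A P.a_subset by blast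
      have id': "ideal (Idl (insert ?p A)) R" by (rule genideal_ideal[OF carr])
      have "Idl A \<subseteq> Idl (insert ?p A)" using subset_Idl_subset[OF carr] by blast
      then have "J n \<subseteq> radical R (Idl (insert ?p A))" using A(3) radical_mono by blast
      moreover have "?p \<in> radical R (Idl (insert ?p A))"
        using genideal_self[OF carr] subset_radical[OF id'] by blast
      ultimately show ?thesis
        unfolding J by (rule add_cgenideal_subset[OF radical_ideal[OF id']])
    qed
    ultimately show ?case using A p sub unfolding C_def by (intro conjI exI[of _ "insert ?p A"]) auto
  qed
  define p where "p n = c (J n)" for n
  define x where "x = rec_nat \<one> (\<lambda>n a. a \<otimes> p n)"
  have x: "x 0 = \<one>" "x (Suc n) = x n \<otimes> p n" for n by (simp_all add: x_def)
  define I where "I = Idl (range (\<lambda>n. x n \<otimes> p n \<otimes> p n))"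
  have pP: "p n \<in> P" for n using c(1) CJ p_def by simp
  have pc [simp]: "p n \<in> carrier R" for n using P.Icarr[OF pP] .
  have xc [simp]: "x n \<in> carrier R" for n by (induction n) (simp_all add: x)
  have gens: "range (\<lambda>n. x n \<otimes> p n \<otimes> p n) \<subseteq> P" using P.I_l_closed pP by auto
  then have carr: "range (\<lambda>n. x n \<otimes> p n \<otimes> p n) \<subseteq> carrier R" using P.a_subset by blast
  have "I \<subseteq> P" unfolding I_def by (rule genideal_minimal[OF Pid gens])
  have Iid: "ideal I R" unfolding I_def by (rule genideal_ideal[OF carr])
  \<comment> \<open>The generator with index 0 is the square of the non-nilpotent
    \<open>p 0\<close>; it makes \<open>I\<close> nonnil, hence decomposable.\<close>
  have "x 0 \<otimes> p 0 \<otimes> p 0 \<in> I" using genideal_self[OF carr] unfolding I_def by blast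
  moreover have "x 0 \<otimes> p 0 \<otimes> p 0 = p 0 [^] (2::nat)" by (simp add: x numeral_2_eq_2)
  moreover have "p 0 [^] (2::nat) \<notin> nilradical R"
    using radicalD_pow[of "p 0" 2 "{\<zero>}"] not_nil[OF CJ[of 0]] unfolding nil_eq p_def[symmetric] by auto
  ultimately have "nonnil R I" by (auto simp: nonnil_def)
  then have "finite (scr I ` carrier R)"
    using S_decomposable_finite_S_colon_radicals dec Iid \<open>I \<subseteq> P\<close> by blast
  then show False
    using almost_regular_sequence_contradiction[of P p J x I, OF Pid pP C_ideal[OF CJ] _ _ _ x I_def]
      J(2) c(2,3) CJ p_def by simp
qed

end

theorem theorem2p12:
  fixes R :: "('a, 'b) ring_scheme" and S :: "'a set"
  assumes "cring R"
    and "submonoid S R"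
    and "nonnil_S_Laskerian R S"
    and "S_decomposable R S (nilradical R)"
  shows "S_Noetherian_spectrum R S"
proof -
  interpret cring_submonoid R S
    using assms(1,2) by (rule cring_submonoid.intro)
  have "radically_S_finite R S P" if P: "primeideal P R" for P
  proof (cases "P \<inter> S = {}")
    case True
    then show ?thesis by (rule radically_S_finite_of_disjoint_prime[OF assms(3,4) P])
  next
    case False
    then show ?thesis using radically_S_finite_meeting_S[OF primeideal.axioms(1)[OF P]] by blast
  qed
  then show ?thesis by (simp add: S_Noetherian_spectrum_def)
qed

end
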